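(* Let $\phi>0$, $\lambda>0$, let $T$ be a random variable with the $\mathrm{IWL}(\phi,\lambda)$ distribution, and let $r\ge 1$ be an integer with $\phi>r$. Then the $r$-th moment of $T$ is $$\mu_r=E[T^r]=\frac{\lambda^r(\phi+\lambda-r)}{(\lambda+\phi)(\phi-1)(\phi-2)\cdots(\phi-r)}.$$
   Context: For $\phi>0$, $\lambda>0$, the inverse weighted Lindley distribution $\mathrm{IWL}(\phi,\lambda)$ is the distribution on $(0,\infty)$ with probability density function $$f(t\mid\phi,\lambda)=\frac{\lambda^{\phi+1}}{(\phi+\lambda)\Gamma(\phi)}\,t^{-\phi-1}\left(1+\frac1t\right)e^{-\lambda/t},\qquad t>0,$$ where $\Gamma$ is the gamma function. *)

theory Defs
  imports "HOL-Probability.Probability"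
begin

definition iwl_density :: "real \<Rightarrow> real \<Rightarrow> real \<Rightarrow> real" where
  "iwl_density \<phi> lam t =
     (if t > 0
      then lam powr (\<phi> + 1) / ((\<phi> + lam) * Gamma \<phi>) * t powr (- \<phi> - 1) * (1 + 1 / t) * exp (- lam / t)
      else 0)"

end

theory Submission imports Defs begin

text \<open>For \<open>a > 0\<close>, the substitution \<open>u = c / t\<close> in Euler's integral shows that
  \<open>t powr (-a - 1) * exp (-c / t)\<close> integrates to \<open>Gamma a / c powr a\<close> over the positive half-line.
  The integrand of the \<open>r\<close>-th moment is a combination of two such functions, with exponents
  \<open>a = \<phi> - r\<close> and \<open>a = \<phi> - r + 1\<close>; the functional equation of \<open>Gamma\<close> does the rest.\<close>

lemma has_bochner_integral_inverse_gamma: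
  fixes a c :: real
  assumes a: "a > 0" and c: "c > 0"
  shows "has_bochner_integral lborel
    (\<lambda>t. indicator {0<..} t * (t powr (- a - 1) * exp (- c / t))) (Gamma a / c powr a)"
proof -
  let ?E = "\<lambda>u::real. u powr (a - 1) / exp u"
  let ?G = "\<lambda>t. t powr (- a - 1) * exp (- c / t)"
  have img: "(\<lambda>t. c / t) ` {0<..} = {0<..}"
  proof (intro equalityI subsetI)
    fix u :: real assume "u \<in> {0<..}"
    \<comment> \<open>The map sending \<open>t\<close> to \<open>c / t\<close> is an involution, so
      \<open>c / u\<close> is the preimage of \<open>u\<close>.\<close>
    then have "u = c / (c / u)" "c / u \<in> {0<..}" using c by auto
    then show "u \<in> (\<lambda>t. c / t) ` {0<..}" by blast
  qed (use c in auto)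
  \<comment> \<open>Euler's integral lives on the closed half-line; dropping the null set
    \<open>{0}\<close> moves it to the open one, which \<open>c / t\<close> maps onto
    itself.\<close>
  have "((\<lambda>u. if u \<in> {0<..} then ?E u else 0) has_integral Gamma a) {0..}"
    by (rule has_integral_spike [of "{0}", OF _ _ Gamma_integral_real [OF a]]) auto
  then have E: "(?E has_integral Gamma a) {0<..}"
    by (subst (asm) has_integral_restrict) auto
  then have "?E absolutely_integrable_on {0<..}" "integral {0<..} ?E = Gamma a"
    by (auto intro!: nonnegative_absolutely_integrable_1 integral_unique)
  moreover have "((\<lambda>t. c / t) has_real_derivative - c / t\<^sup>2) (at t within {0<..})"
    if "t \<in> {0<..}" for t
    using that by (auto intro!: derivative_eq_intros simp: power2_eq_square)
  moreover have "inj_on (\<lambda>t. c / t) {0<..}"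
    using c by (auto intro!: inj_onI)
  ultimately have H: "((\<lambda>t. \<bar>- c / t\<^sup>2\<bar> * ?E (c / t)) has_integral Gamma a) {0<..}"
    using has_absolute_integral_change_of_variables_1'
        [of "{0<..}" "\<lambda>t. c / t" "\<lambda>t. - c / t\<^sup>2" ?E "Gamma a"] img
    by (auto simp: has_integral_integrable_integral set_lebesgue_integral_eq_integral)
  \<comment> \<open>The Jacobian \<open>c / t\<^sup>2\<close> adds 1 to the exponent of
    \<open>c\<close> and -2 to that of \<open>t\<close>.\<close>
  have eq: "\<bar>- c / t\<^sup>2\<bar> * ?E (c / t) = c powr a * ?G t" if "t > 0" for t
  proof -
    have "c / t\<^sup>2 * (c / t) powr (a - 1) = c powr (1 + (a - 1)) * t powr (- 2 - (a - 1))"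
      using that c by (simp add: powr_divide powr_diff powr_add powr_minus power2_eq_square field_simps)
    also have "- 2 - (a - 1) = - a - 1" by simp
    finally show ?thesis using that c by (simp add: exp_minus divide_inverse)
  qed
  have "((\<lambda>t. c powr a * ?G t) has_integral Gamma a) {0<..}"
    by (rule has_integral_eq [OF _ H]) (use eq in auto)
  from has_integral_mult_right [OF this, of "inverse (c powr a)"]
  have "(?G has_integral Gamma a / c powr a) {0<..}"
    using c by (simp add: field_simps)
  \<comment> \<open>Nonnegativity of the integrand turns the gauge integral into a Lebesgue
    integral.\<close>
  then have "(\<integral>\<^sup>+t. ennreal (indicator {0<..} t * ?G t) \<partial>lborel) = ennreal (Gamma a / c powr a)"
    by (intro nn_integral_has_integral_lebesgue) auto
  then show ?thesis
    using a c by (intro has_bochner_integral_nn_integral) (auto simp: Gamma_real_pos less_imp_le)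
qed

text \<open>Iterates the functional equation; \<open>x > real r\<close> keeps every argument
  positive, away from the poles. It produces the product in the denominator of the moment.\<close>

lemma Gamma_eq_prod_times_Gamma_diff:
  fixes x :: real
  assumes "x > real r"
  shows "Gamma x = (\<Prod>i = 1..r. x - real i) * Gamma (x - real r)"
  using assms
proof (induction r)
  case (Suc r)
  have "Gamma (x - real (Suc r) + 1) = (x - real (Suc r)) * Gamma (x - real (Suc r))"
    using Suc.prems by (intro Gamma_plus1) (auto elim!: nonpos_Ints_cases)
  then show ?case using Suc by simp
qed simp

theorem proposition3p1:
  fixes M :: "'a measure" and T :: "'a \<Rightarrow> real" and \<phi> lam :: real and r :: nat
  assumes "prob_space M"
    and "\<phi> > 0" and "lam > 0"
    and "distributed M lborel T (\<lambda>t. ennreal (iwl_density \<phi> lam t))"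
    and "r \<ge> 1" and "\<phi> > real r"
  shows "integrable M (\<lambda>\<omega>. T \<omega> ^ r) \<and>
    prob_space.expectation M (\<lambda>\<omega>. T \<omega> ^ r) =
      lam ^ r * (\<phi> + lam - real r) / ((lam + \<phi>) * (\<Prod>i = 1..r. \<phi> - real i))"
proof -
  define a where "a = \<phi> - real r"
  define C where "C = lam powr (\<phi> + 1) / ((\<phi> + lam) * Gamma \<phi>)"
  define P where "P = (\<Prod>i = 1..r. \<phi> - real i)"
  let ?g = "\<lambda>b t. indicator {0<..} t * (t powr (- b - 1) * exp (- lam / t))"
  have a: "a > 0" using assms(6) by (simp add: a_def)
  have nonneg: "0 \<le> iwl_density \<phi> lam t" for t
    using assms(2,3) by (simp add: iwl_density_def Gamma_real_pos less_imp_le)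
  \<comment> \<open>The factor \<open>t ^ r\<close> lowers the parameter from \<open>\<phi>\<close>
    to \<open>a\<close>, and the \<open>1 / t\<close> in \<open>1 + 1 / t\<close> gives the second
    term, with \<open>a + 1\<close>. For \<open>t \<le> 0\<close> both sides vanish.\<close>
  have "iwl_density \<phi> lam t * t ^ r = C * (?g a t + ?g (a + 1) t)" for t
  proof (cases "t > 0")
    case True
    have "t powr (- a - 1) = t powr (- \<phi> - 1) * t ^ r"
      using True by (simp add: a_def algebra_simps powr_realpow [symmetric] flip: powr_add)
    moreover have "t powr (- (a + 1) - 1) = t powr (- a - 1) / t"
      using True powr_diff [of t "- a - 1" 1] by (simp add: algebra_simps)
    ultimately show ?thesis
      using True by (simp add: iwl_density_def flip: C_def) (simp add: algebra_simps)
  qed (simp add: iwl_density_def)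
  moreover have "has_bochner_integral lborel (\<lambda>t. C * (?g a t + ?g (a + 1) t))
      (C * (Gamma a / lam powr a + Gamma (a + 1) / lam powr (a + 1)))"
    using a assms(3)
    by (intro has_bochner_integral_mult_right has_bochner_integral_add
          has_bochner_integral_inverse_gamma) auto
  \<comment> \<open>The bracket equals \<open>Gamma a * (lam + a) / lam powr (a + 1)\<close>.
    \<open>Gamma a\<close> cancels against \<open>Gamma \<phi> = P * Gamma a\<close> in
    \<open>C\<close>, and the powers of \<open>lam\<close> leave \<open>lam ^ r\<close>.\<close>
  moreover have "C * (Gamma a / lam powr a + Gamma (a + 1) / lam powr (a + 1)) =
      lam ^ r * (\<phi> + lam - real r) / ((lam + \<phi>) * P)"
  proof -
    have "Gamma (a + 1) = a * Gamma a"
      using a by (intro Gamma_plus1) (auto elim!: nonpos_Ints_cases)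
    moreover have "Gamma \<phi> = P * Gamma a"
      using Gamma_eq_prod_times_Gamma_diff [OF assms(6)] by (simp add: P_def a_def)
    moreover have "P > 0"
      unfolding P_def using assms(6) by (intro prod_pos) auto
    moreover have "lam powr (\<phi> + 1) = lam ^ r * (lam * lam powr a)"
      using assms(3) by (simp add: a_def powr_diff powr_add powr_realpow)
    moreover have "lam powr (a + 1) = lam * lam powr a" "\<phi> + lam - real r = a + lam"
      using assms(3) by (simp_all add: a_def powr_add)
    moreover have "Gamma a > 0" using a by (rule Gamma_real_pos)
    ultimately show ?thesis
      using assms(2,3) by (simp add: C_def divide_simps) (simp add: algebra_simps)
  qed
  ultimately have "has_bochner_integral lborel (\<lambda>t. iwl_density \<phi> lam t * t ^ r)
      (lam ^ r * (\<phi> + lam - real r) / ((lam + \<phi>) * P))"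
    by simp
  \<comment> \<open>As the density is nonnegative, integrability and expectation under
    \<open>M\<close> reduce to those of density times \<open>t ^ r\<close> under
    \<open>lborel\<close>.\<close>
  then show ?thesis
    using distributed_integrable [OF assms(4), of "\<lambda>t. t ^ r"]
      distributed_integral [OF assms(4), of "\<lambda>t. t ^ r"] nonneg
    by (simp add: has_bochner_integral_iff P_def)
qed

end
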